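(* Let $Y$ be a connected space and $p\in Y$ such that $X=Y\setminus\{p\}$ is almost zero-dimensional. If $K\subset X$ is $\sigma$-compact, then $Y\setminus K$ is connected.
   Context: All spaces are separable and metrizable. A subset $A$ of $X$ is a C-set in $X$ if it is an intersection of clopen subsets of $X$. $X$ is almost zero-dimensional if every point has a neighborhood basis consisting of C-sets in $X$. *)

theory Defs
  imports "HOL-Analysis.Analysis"
begin

definition C_set :: "'a topology \<Rightarrow> 'a set \<Rightarrow> bool" where
  "C_set X A \<longleftrightarrow>
     (\<exists>\<U>. (\<forall>U\<in>\<U>. closedin X U \<and> openin X U) \<and> A = topspace X \<inter> \<Inter>\<U>)"

definition almost_zero_dimensional :: "'a topology \<Rightarrow> bool" where
  "almost_zero_dimensional X \<longleftrightarrow>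
     (\<forall>x\<in>topspace X. \<forall>U. openin X U \<and> x \<in> U \<longrightarrow>
        (\<exists>V. C_set X V \<and> x \<in> X interior_of V \<and> V \<subseteq> U))"

definition sigma_compactin :: "'a topology \<Rightarrow> 'a set \<Rightarrow> bool" where
  "sigma_compactin X K \<longleftrightarrow>
     (\<exists>C :: nat \<Rightarrow> 'a set. (\<forall>n. compactin X (C n)) \<and> K = (\<Union>n. C n))"

end

theory Submission
  imports Defs
begin

text \<open>
  A separation of \<open>Y - K\<close> extends, by hereditary normality, to disjoint open sets \<open>U \<ni> p\<close> and
  \<open>V\<close> of \<open>Y\<close> whose common complement \<open>S \<subseteq> K\<close> is closed and \<open>\<sigma>\<close>-compact. Such an \<open>S\<close> is a C-set in
  \<open>X = Y - {p}\<close>, so some clopen \<open>W \<supseteq> S\<close> of \<open>X\<close> omits a given point of \<open>V\<close>. Then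
  \<open>V - W = (V \<union> S) - W\<close> is nonempty and clopen in \<open>Y\<close>, because \<open>V \<union> S\<close> is closed in \<open>Y\<close> and omits \<open>p\<close>.
\<close>

lemma metrizable_separable_imp_second_countable:
  assumes "metrizable_space X" "separable_space X"
  shows "second_countable X"
proof -
  obtain M d where "Metric_space M d" and X: "X = Metric_space.mtopology M d"
    using assms(1) unfolding metrizable_space_def by blast
  then interpret Metric_space M d by simp
  obtain C where C: "countable C" "mtopology closure_of C = M"
    using assms(2) unfolding separable_space_def X by auto
  let ?\<B> = "(\<lambda>(c, n). mball c (inverse (real (Suc n)))) ` (C \<times> UNIV)"
  have "\<exists>V\<in>?\<B>. x \<in> V \<and> V \<subseteq> U" if U: "openin mtopology U" "x \<in> U" for U x
  proof -
    obtain r where r: "r > 0" "mball x r \<subseteq> U" and "x \<in> M"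
      using U openin_mtopology by blast
    \<comment> \<open>Half of \<open>r\<close>: a ball of this radius about a centre
      \<open>c\<close> that is itself this close to \<open>x\<close> stays inside
      \<open>mball x r\<close>.\<close>
    obtain n where n: "inverse (real (Suc n)) < r / 2"
      using reals_Archimedean[of "r / 2"] r(1) by auto
    have "inverse (real (Suc n)) > 0" by simp
    then obtain c where c: "c \<in> C" "c \<in> mball x (inverse (real (Suc n)))"
      using \<open>x \<in> M\<close> C(2) unfolding metric_closure_of by blast
    have "mball c (inverse (real (Suc n))) \<subseteq> mball x r"
      using c n \<open>x \<in> M\<close> commute[of c x] by (intro mball_subset) (auto simp del: of_nat_Suc)
    moreover have "x \<in> mball c (inverse (real (Suc n)))"
      using c(2) commute by auto
    ultimately show ?thesis
      using c(1) r(2) by (intro bexI[of _ "mball c (inverse (real (Suc n)))"]) auto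
  qed
  moreover have "countable ?\<B>" using C(1) by simp
  moreover have "\<forall>V\<in>?\<B>. openin mtopology V" by auto
  ultimately show ?thesis
    unfolding second_countable_def X by (intro exI[of _ ?\<B>] conjI allI impI) auto
qed

lemma C_set_clopen_superset:
  assumes "C_set X N" "x \<in> topspace X" "x \<notin> N"
  obtains E where "openin X E" "closedin X E" "x \<in> E" "E \<inter> N = {}"
proof -
  from assms obtain U where "openin X U" "closedin X U" "N \<subseteq> U" "x \<notin> U"
    unfolding C_set_def by blast
  with assms(2) show thesis
    by (intro that[of "topspace X - U"]) auto
qed

text \<open>Each point of \<open>C\<close> lies in a clopen set missing \<open>N\<close>. By
  compactness finitely many of these cover \<open>C\<close>, and a finite union of clopen sets is
  again clopen.\<close>

lemma compactin_C_set_separation: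
  assumes "compactin X C" "C_set X N" "C \<inter> N = {}"
  obtains E where "openin X E" "closedin X E" "C \<subseteq> E" "E \<inter> N = {}"
proof -
  let ?\<U> = "{E. openin X E \<and> closedin X E \<and> E \<inter> N = {}}"
  have "C \<subseteq> \<Union>?\<U>"
  proof
    fix x assume "x \<in> C"
    then have "x \<in> topspace X" "x \<notin> N"
      using assms compactin_subset_topspace by blast+
    then show "x \<in> \<Union>?\<U>"
      using C_set_clopen_superset[OF assms(2)] by blast
  qed
  then obtain \<F> where "finite \<F>" "\<F> \<subseteq> ?\<U>" "C \<subseteq> \<Union>\<F>"
    using compactinD[OF assms(1), of ?\<U>] by auto
  then show thesis
    by (intro that[of "\<Union>\<F>"]) (auto intro: closedin_Union)
qed

text \<open>The complement of \<open>S\<close> is covered by the interiors of countably many C-sets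
  \<open>N m\<close> missing \<open>S\<close>, and each compact piece \<open>C n\<close> of
  \<open>S\<close> can be separated from each \<open>N m\<close> by a clopen set. A diagonal choice
  \<open>D n\<close> of finite intersections makes the union of all \<open>D n\<close> closed as
  well as open: near any point outside it, only finitely many \<open>D n\<close> can occur.\<close>

lemma closedin_sigma_compactin_imp_C_set:
  assumes "second_countable X" "almost_zero_dimensional X"
    and S: "closedin X S" "sigma_compactin X S"
  shows "C_set X S"
proof (cases "S = topspace X")
  case True
  then show ?thesis unfolding C_set_def by (intro exI[of _ "{}"]) auto
next
  case False
  let ?\<U> = "{X interior_of N |N. C_set X N \<and> N \<inter> S = {}}"
  have "\<exists>N. C_set X N \<and> x \<in> X interior_of N \<and> N \<inter> S = {}" if x: "x \<in> topspace X - S" for x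
  proof -
    have "openin X (topspace X - S)" "x \<in> topspace X" using S x by blast+
    then obtain N where "C_set X N" "x \<in> X interior_of N" "N \<subseteq> topspace X - S"
      using assms(2)[unfolded almost_zero_dimensional_def, rule_format, of x "topspace X - S"] x
      by blast
    then show ?thesis by blast
  qed
  then have "topspace X - S \<subseteq> \<Union>?\<U>"
    by blast
  moreover have "Lindelof_space (subtopology X (topspace X - S))"
    using assms(1) by (intro second_countable_imp_Lindelof_space second_countable_subtopology)
  moreover have "\<forall>U\<in>?\<U>. openin X U"
    by auto
  ultimately obtain \<V> where \<V>: "countable \<V>" "\<V> \<subseteq> ?\<U>" "topspace X - S \<subseteq> \<Union>\<V>"
    by (metis (no_types, lifting) Diff_subset Lindelof_space_subtopology_subset)
  \<comment> \<open>The enumeration \<open>from_nat_into\<close> stays inside its set only if that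
    set is nonempty; this is why the case where \<open>S\<close> is the whole space was split
    off.\<close>
  have "\<V> \<noteq> {}"
    using False \<V>(3) closedin_subset[OF S(1)] by blast
  then have "from_nat_into \<V> n \<in> ?\<U>" for n
    by (rule subsetD[OF \<V>(2) from_nat_into])
  then have "\<exists>N. C_set X N \<and> N \<inter> S = {} \<and> from_nat_into \<V> n = X interior_of N" for n
    by fast
  then obtain N where N: "\<And>n. C_set X (N n)" "\<And>n. N n \<inter> S = {}"
    and \<V>_N: "\<And>n. from_nat_into \<V> n = X interior_of N n"
    by metis
  have cover: "\<exists>n. x \<in> X interior_of N n" if x: "x \<in> topspace X - S" for x
  proof -
    obtain V where "V \<in> \<V>" "x \<in> V" using \<V>(3) x by blast
    then show ?thesis using from_nat_into_surj[OF \<V>(1), of V] \<V>_N by auto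
  qed
  obtain C :: "nat \<Rightarrow> 'a set" where C: "\<And>n. compactin X (C n)" "S = (\<Union>n. C n)"
    using S(2) unfolding sigma_compactin_def by blast
  have "\<exists>E. openin X E \<and> closedin X E \<and> C n \<subseteq> E \<and> E \<inter> N m = {}" for n m
  proof -
    have "C n \<inter> N m = {}" using N(2) C(2) by blast
    then show ?thesis using compactin_C_set_separation[OF C(1) N(1)] by metis
  qed
  then obtain E where E: "\<And>n m. openin X (E n m)" "\<And>n m. closedin X (E n m)"
      "\<And>n m. C n \<subseteq> E n m" "\<And>n m. E n m \<inter> N m = {}"
    by metis
  have clopen: "\<exists>W. closedin X W \<and> openin X W \<and> S \<subseteq> W \<and> v \<notin> W" if v: "v \<in> topspace X - S" for v
  proof -
    obtain k where k: "v \<in> N k"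
      using cover[OF v] interior_of_subset by fastforce
    \<comment> \<open>The bound grows with \<open>n\<close>, so \<open>N j\<close> is missed by
      every \<open>D n\<close> with \<open>n \<ge> j\<close>. The shift by \<open>k\<close> makes
      every \<open>D n\<close>, including \<open>D 0\<close>, miss \<open>N k\<close> and hence
      \<open>v\<close>.\<close>
    define D where "D n = (\<Inter>m\<le>n+k. E n m)" for n
    have D: "openin X (D n)" "closedin X (D n)" "C n \<subseteq> D n" for n
      unfolding D_def using E(1,2,3) by (intro openin_INT2 closedin_INT INT_greatest; simp)+
    have disj: "D n \<inter> N m = {}" if "m \<le> n + k" for n m
      using E(4)[of n m] that unfolding D_def by blast
    have "openin X (topspace X - (\<Union>n. D n))"
    proof (subst openin_subopen, intro ballI)
      fix x assume x: "x \<in> topspace X - (\<Union>n. D n)"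
      then have "x \<in> topspace X - S" using C(2) D(3) by blast
      then obtain j where j: "x \<in> X interior_of N j" using cover by blast
      \<comment> \<open>Only the finitely many closed sets \<open>D n\<close> with
        \<open>n < j\<close> have to be removed by hand; the later ones already miss
        \<open>N j\<close>.\<close>
      define T where "T = X interior_of N j - (\<Union>n<j. D n)"
      have "openin X T"
        unfolding T_def using D by (intro openin_diff closedin_Union) auto
      moreover have "x \<in> T" using x j unfolding T_def by blast
      moreover have "T \<inter> D n = {}" for n
        using disj[of j n] interior_of_subset[of X "N j"] unfolding T_def
        by (cases "n < j") auto
      then have "T \<subseteq> topspace X - (\<Union>n. D n)"
        using openin_subset[OF \<open>openin X T\<close>] by blast
      ultimately show "\<exists>T. openin X T \<and> x \<in> T \<and> T \<subseteq> topspace X - (\<Union>n. D n)"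
        by blast
    qed
    moreover have "openin X (\<Union>n. D n)" using D by blast
    ultimately have "closedin X (\<Union>n. D n)"
      using closedin_def openin_subset by blast
    moreover have "v \<notin> (\<Union>n. D n)" using disj[of k] k by auto
    moreover have "S \<subseteq> (\<Union>n. D n)" using C(2) D(3) by blast
    ultimately show ?thesis using \<open>openin X (\<Union>n. D n)\<close> by blast
  qed
  then have "S = topspace X \<inter> \<Inter>{W. closedin X W \<and> openin X W \<and> S \<subseteq> W}"
    using closedin_subset[OF S(1)] by blast
  then show ?thesis
    unfolding C_set_def by (intro exI[of _ "{W. closedin X W \<and> openin X W \<and> S \<subseteq> W}"]) simp
qed

lemma sigma_compactin_closed_subset:
  assumes "sigma_compactin X K" "closedin X S" "S \<subseteq> K"
  shows "sigma_compactin X S"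
proof -
  obtain C :: "nat \<Rightarrow> 'a set" where "\<forall>n. compactin X (C n)" "K = (\<Union>n. C n)"
    using assms(1) unfolding sigma_compactin_def by blast
  then show ?thesis
    using assms(2,3) unfolding sigma_compactin_def
    by (intro exI[of _ "\<lambda>n. S \<inter> C n"]) (auto intro: closed_Int_compactin)
qed

theorem theorem4p8:
  fixes Y :: "'a topology" and p :: 'a and K :: "'a set"
  assumes "metrizable_space Y" and "separable_space Y"
    and "connected_space Y"
    and "p \<in> topspace Y"
    and "almost_zero_dimensional (subtopology Y (topspace Y - {p}))"
    and "sigma_compactin (subtopology Y (topspace Y - {p})) K"
  shows "connected_space (subtopology Y (topspace Y - K))"
proof (rule ccontr)
  define X where "X = subtopology Y (topspace Y - {p})"
  assume "\<not> connected_space (subtopology Y (topspace Y - K))"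
  then have "\<not> connectedin Y (topspace Y - K)"
    by (simp add: connectedin_def)
  then obtain A B where "A \<union> B = topspace Y - K" "A \<noteq> {}" "B \<noteq> {}" "separatedin Y A B"
    unfolding connectedin_eq_not_separated by blast
  moreover have "p \<notin> K"
    using assms(6) compactin_subset_topspace unfolding sigma_compactin_def by fastforce
  \<comment> \<open>As \<open>p\<close> is not in \<open>K\<close>, it lies in one of the two sides;
    by symmetry that side is called \<open>A\<close>.\<close>
  ultimately obtain A B where AB: "A \<union> B = topspace Y - K" "p \<in> A" "B \<noteq> {}" "separatedin Y A B"
    using assms(4) separatedin_sym by (metis DiffI UnE sup_commute)
  obtain U V where UV: "openin Y U" "openin Y V" "A \<subseteq> U" "B \<subseteq> V" "disjnt U V"
    using metrizable_space_separation[OF assms(1) AB(4)] by blast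
  define S where "S = topspace Y - (U \<union> V)"
  have "S \<subseteq> K" using AB(1) UV(3,4) unfolding S_def by blast
  have topX: "topspace X = topspace Y - {p}" unfolding X_def by auto
  \<comment> \<open>Points are closed in \<open>Y\<close>, so sets open in \<open>X\<close> are open
    in \<open>Y\<close>. Sets closed in \<open>X\<close> may still have \<open>p\<close> as a limit
    point in \<open>Y\<close>.\<close>
  have "openin Y (topspace Y - {p})"
    using assms(1,4) by (simp add: metrizable_imp_t1_space openin_diff closedin_t1_singleton)
  then have openX: "openin X T \<longleftrightarrow> openin Y T \<and> T \<subseteq> topspace Y - {p}" for T
    unfolding X_def by (simp add: openin_open_subtopology)
  have "closedin Y S" unfolding S_def using UV by blast
  moreover have "S \<subseteq> topspace Y - {p}" unfolding S_def using UV AB by blast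
  ultimately have clS: "closedin X S"
    unfolding X_def by (simp add: closedin_subset_topspace)
  have "second_countable X"
    unfolding X_def using assms(1,2) second_countable_subtopology
      metrizable_separable_imp_second_countable by blast
  then have "C_set X S"
    using assms(5,6)[folded X_def] clS \<open>S \<subseteq> K\<close>
    by (metis closedin_sigma_compactin_imp_C_set sigma_compactin_closed_subset)
  obtain v where "v \<in> B" using AB by blast
  then have v: "v \<in> V" "v \<in> topspace X" "v \<notin> S"
    using UV AB openin_subset[OF UV(2)] unfolding topX S_def disjnt_def by auto
  \<comment> \<open>\<open>G\<close> is the complement in \<open>X\<close> of the clopen set
    \<open>W\<close> of the overview, so that \<open>V - W\<close> becomes
    \<open>V \<inter> G\<close>.\<close>
  obtain G where G: "openin X G" "closedin X G" "v \<in> G" "G \<inter> S = {}"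
    using C_set_clopen_superset[OF \<open>C_set X S\<close> v(2,3)] by blast
  have "openin Y (V \<inter> G)" using G openX UV by blast
  moreover have "closedin Y (V \<inter> G)"
  proof -
    have "openin X (topspace X - G)" using G by blast
    then have "openin Y (U \<union> (topspace X - G))" using openX UV by blast
    \<comment> \<open>A point outside \<open>U\<close> is not \<open>p\<close>; if it is also
      outside \<open>topspace X - G\<close>, it lies in \<open>G\<close>, hence not in
      \<open>S\<close>, which leaves only \<open>V\<close>. Thus \<open>U\<close> keeps
      \<open>p\<close> away from the closure of \<open>V \<inter> G\<close>.\<close>
    moreover have "V \<inter> G = topspace Y - (U \<union> (topspace X - G))"
      using G(4) UV AB(2) openin_subset[OF UV(2)] unfolding topX S_def disjnt_def by blast
    ultimately show ?thesis by (metis openin_closedin_eq closedin_diff closedin_topspace)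
  qed
  moreover have "p \<notin> V \<inter> G" "v \<in> V \<inter> G"
    using AB UV G v unfolding disjnt_def by auto
  ultimately show False
    using assms(3,4) unfolding connected_space_clopen_in by blast
qed

end
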